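(* Let $\lambda>0$ and let $p_n\in(0,1)$ be a sequence with $p_n\sim\lambda/n$ as $n\to\infty$. Let $\mathbf{D}_{n,p_n}$ be the degree of a uniformly chosen vertex of the random cluster graph $\mathbf{CG}_{n,p_n}$. Then $$\lim_{n\to\infty}\mathbb{P}(\mathbf{D}_{n,p_n}=0)=\frac{\sqrt{4\lambda+1}-1}{2\lambda},\qquad\lim_{n\to\infty}\mathbb{P}(\mathbf{D}_{n,p_n}=1)=1-\frac{\sqrt{4\lambda+1}-1}{2\lambda}.$$ In particular, for $p_n\sim1/n$ we have $\mathbb{P}(\mathbf{D}_{n,p_n}=0)\to\rho^{-1}$, where $\rho=\frac{\sqrt5+1}{2}$ is the golden ratio.
   Context: A cluster graph is a simple undirected graph on the labelled vertex set $\{1,\dots,n\}$ every connected component of which is a complete graph. For $p\in(0,1)$, the random cluster graph $\mathbf{CG}_{n,p}$ is the Erdős–Rényi random graph on $n$ vertices with edge probability $p$ (each of the $\binom n2$ edges present independently with probability $p$), conditioned on the event that it is a cluster graph. The uniform vertex is chosen independently of the graph. $f\sim g$ means $f/g\to1$. *)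

theory Defs
  imports "HOL-Probability.Probability" "HOL-Library.Landau_Symbols" "HOL-Library.Ramsey"
begin

text \<open>
  A simple graph with vertex set \<open>{1..n}\<close> is given by its edge set, a subset of
  \<open>nsets {1..n} 2\<close>, the set of 2-element subsets of \<open>{1..n}\<close>.
\<close>

definition graph_components :: "'a set \<Rightarrow> 'a set set \<Rightarrow> 'a set set" where
  "graph_components V E = V // {(u, v) \<in> V \<times> V. (u, v) \<in> {(x, y). {x, y} \<in> E}\<^sup>*}"

definition cluster_graph :: "nat \<Rightarrow> nat set set \<Rightarrow> bool" where
  "cluster_graph n E \<longleftrightarrow>
     E \<subseteq> nsets {1..n} 2 \<and> (\<forall>C \<in> graph_components {1..n} E. nsets C 2 \<subseteq> E)"

definition erdos_renyi :: "nat \<Rightarrow> real \<Rightarrow> nat set set pmf" where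
  "erdos_renyi n p =
     map_pmf (\<lambda>x. {e \<in> nsets {1..n} 2. x e})
       (Pi_pmf (nsets {1..n} 2) False (\<lambda>_. bernoulli_pmf p))"

definition random_cluster_graph :: "nat \<Rightarrow> real \<Rightarrow> nat set set pmf" where
  "random_cluster_graph n p = cond_pmf (erdos_renyi n p) {E. cluster_graph n E}"

definition vertex_degree :: "'a set set \<Rightarrow> 'a \<Rightarrow> nat" where
  "vertex_degree E v = card {e \<in> E. v \<in> e}"

text \<open>
  The law of the degree of a uniform vertex, chosen independently of the graph. It is
  meaningful only for \<open>n > 0\<close>, since the uniform distribution on \<open>{1..0} = {}\<close> is unspecified.
\<close>

definition degree_pmf :: "nat \<Rightarrow> real \<Rightarrow> nat pmf" where
  "degree_pmf n p =
     map_pmf (\<lambda>(E, v). vertex_degree E v)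
       (pair_pmf (random_cluster_graph n p) (pmf_of_set {1..n}))"

text \<open>
  The conditioning event has positive probability, as \<open>cond_pmf\<close> requires: the empty
  graph is a cluster graph.
\<close>

lemma erdos_renyi_cluster_graph_nonempty:
  assumes "0 < p" "p < 1"
  shows "set_pmf (erdos_renyi n p) \<inter> {E. cluster_graph n E} \<noteq> {}"
proof -
  have fin: "finite (nsets {1..n} 2)"
    by (simp add: finite_imp_finite_nsets)
  have "(\<lambda>_. False) \<in> set_pmf (Pi_pmf (nsets {1..n} 2) False (\<lambda>_. bernoulli_pmf p))"
    unfolding set_Pi_pmf[OF fin] using assms by (simp add: PiE_dflt_def)
  hence "{} \<in> set_pmf (erdos_renyi n p)"
    by (force simp: erdos_renyi_def)
  moreover have "cluster_graph n {}"
  proof -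
    have "nsets C 2 = {}" if C: "C \<in> graph_components {1..n} {}" for C
    proof -
      from C obtain v where "C \<subseteq> {v}"
        by (auto simp: graph_components_def quotient_def)
      thus ?thesis
        by (auto simp: nsets_def card_2_iff)
    qed
    thus ?thesis by (simp add: cluster_graph_def)
  qed
  ultimately show ?thesis by auto
qed

end

theory Submission
  imports Defs
begin

text \<open>
  With \<open>x = p / (1 - p)\<close> and \<open>S n\<close> the sum of \<open>x ^ card E\<close> over all cluster graphs on \<open>n\<close>
  vertices, splitting off the clique of a vertex shows that its degree is \<open>k\<close> with probability
  \<open>(n - 1 choose k) x ^ (k + 1 choose 2) S (n - 1 - k) / S n\<close>. When \<open>n x\<close> is bounded, the terms
  with \<open>k \<ge> 2\<close> are negligible, so the ratios \<open>r m = S (m - 1) / S m\<close> satisfy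
  \<open>1 / r (m + 1) = 1 + m x r m + o(1)\<close>. In the variable \<open>ln r \<le> 0\<close> this recurrence is a contraction
  with factor \<open>lam / (1 + lam)\<close> as long as \<open>m x\<close> is close to \<open>lam\<close>, which is the case for the
  last boundedly many steps before \<open>m = n\<close>. Hence \<open>r n\<close> tends to the positive root of
  \<open>lam r\<^sup>2 + r = 1\<close>.
\<close>

section \<open>Cluster graphs as edge sets with transitive adjacency\<close>

definition cluster_edge_sets :: "'a set \<Rightarrow> 'a set set set" where
  "cluster_edge_sets V = {E. E \<subseteq> nsets V 2 \<and>
     (\<forall>u v w. {u, v} \<in> E \<longrightarrow> {v, w} \<in> E \<longrightarrow> u \<noteq> w \<longrightarrow> {u, w} \<in> E)}"

definition neighbours :: "'a set set \<Rightarrow> 'a \<Rightarrow> 'a set" where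
  "neighbours E v = {u. {v, u} \<in> E}"

definition cluster_weight :: "real \<Rightarrow> 'a set \<Rightarrow> real" where
  "cluster_weight x V = (\<Sum>E\<in>cluster_edge_sets V. x ^ card E)"

text \<open>In the recursion \<open>k\<close> is the degree of a fixed vertex, so that its clique
  has \<open>Suc k\<close> vertices. For \<open>x = 1\<close> the values are the Bell numbers. The
  agreement with \<open>cluster_weight\<close> is proved in
  \<open>cluster_weight_eq\<close>.\<close>

fun cluster_sum :: "real \<Rightarrow> nat \<Rightarrow> real" where
  "cluster_sum x 0 = 1"
| "cluster_sum x (Suc n) =
     (\<Sum>k\<le>n. real (n choose k) * x ^ (Suc k choose 2) * cluster_sum x (n - k))"

text \<open>The ends of a path of length two share a component, so complete components force
  transitivity. Conversely, transitivity collapses reachability to equality or a single edge. The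
  transitive form avoids quotients and passes directly to subsets of the vertices.\<close>

lemma cluster_graph_iff: "cluster_graph n E \<longleftrightarrow> E \<in> cluster_edge_sets {1..n}"
proof
  assume cl: "cluster_graph n E"
  then have sub: "E \<subseteq> nsets {1..n} 2" by (simp add: cluster_graph_def)
  have "{u, w} \<in> E" if uv: "{u, v} \<in> E" and vw: "{v, w} \<in> E" and "u \<noteq> w" for u v w
  proof -
    let ?R = "{(x, y). {x, y} \<in> E}"
    let ?r = "{(u, v) \<in> {1..n} \<times> {1..n}. (u, v) \<in> ?R\<^sup>*}"
    have V: "u \<in> {1..n}" "v \<in> {1..n}" "w \<in> {1..n}"
      using subsetD[OF sub uv] subsetD[OF sub vw] unfolding doubleton_in_nsets_2 by auto
    have "(u, v) \<in> ?R" "(v, w) \<in> ?R" using uv vw by auto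
    then have "(u, w) \<in> ?R\<^sup>*" by (meson r_into_rtrancl rtrancl_trans)
    then have "u \<in> ?r `` {u}" "w \<in> ?r `` {u}" using V by auto
    then have "{u, w} \<in> nsets (?r `` {u}) 2" using \<open>u \<noteq> w\<close> by simp
    moreover have "?r `` {u} \<in> graph_components {1..n} E"
      unfolding graph_components_def by (rule quotientI) fact
    ultimately show ?thesis using cl unfolding cluster_graph_def by blast
  qed
  with sub show "E \<in> cluster_edge_sets {1..n}" unfolding cluster_edge_sets_def by blast
next
  assume "E \<in> cluster_edge_sets {1..n}"
  then have sub: "E \<subseteq> nsets {1..n} 2"
    and tr: "\<And>u v w. {u, v} \<in> E \<Longrightarrow> {v, w} \<in> E \<Longrightarrow> u \<noteq> w \<Longrightarrow> {u, w} \<in> E"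
    by (auto simp: cluster_edge_sets_def)
  let ?R = "{(x, y). {x, y} \<in> E}"
  have reach: "u = w \<or> {u, w} \<in> E" if "(u, w) \<in> ?R\<^sup>*" for u w
    using that
  proof (induction rule: rtrancl_induct)
    case (step y z)
    then show ?case using tr[of u y z] by auto
  qed auto
  have "nsets C 2 \<subseteq> E" if C: "C \<in> graph_components {1..n} E" for C
  proof
    fix e assume "e \<in> nsets C 2"
    then obtain a b where e: "e = {a, b}" "a \<in> C" "b \<in> C" "a \<noteq> b" by (auto simp: nsets_2_eq)
    from C obtain c where c: "C = {(u, v) \<in> {1..n} \<times> {1..n}. (u, v) \<in> ?R\<^sup>*} `` {c}"
      unfolding graph_components_def by (rule quotientE)
    have "(c, a) \<in> ?R\<^sup>*" "(c, b) \<in> ?R\<^sup>*"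
      using e(2,3) unfolding c by blast+
    then have "c = a \<or> {a, c} \<in> E" "c = b \<or> {c, b} \<in> E"
      using reach[of c a] reach[of c b] by (simp_all add: insert_commute)
    then show "e \<in> E" using e(1,4) tr[of a c b] by blast
  qed
  with sub show "cluster_graph n E" by (auto simp: cluster_graph_def)
qed

lemma finite_cluster_edge_sets: "finite V \<Longrightarrow> finite (cluster_edge_sets V)"
  by (rule finite_subset[of _ "Pow (nsets V 2)"])
    (auto simp: cluster_edge_sets_def finite_imp_finite_nsets)

lemma cluster_edge_setsD:
  assumes "E \<in> cluster_edge_sets V" "{a, b} \<in> E"
  shows "a \<in> V \<and> b \<in> V \<and> a \<noteq> b"
  using assms doubleton_in_nsets_2[of a b V] unfolding cluster_edge_sets_def by blast

lemma cluster_edge_sets_trans: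
  "E \<in> cluster_edge_sets V \<Longrightarrow> {u, v} \<in> E \<Longrightarrow> {v, w} \<in> E \<Longrightarrow> u \<noteq> w \<Longrightarrow> {u, w} \<in> E"
  unfolding cluster_edge_sets_def by blast

lemma cluster_edge_setsI:
  assumes "E \<subseteq> nsets V 2"
    and "\<And>u v w. {u, v} \<in> E \<Longrightarrow> {v, w} \<in> E \<Longrightarrow> u \<noteq> w \<Longrightarrow> {u, w} \<in> E"
  shows "E \<in> cluster_edge_sets V"
  using assms unfolding cluster_edge_sets_def by blast

section \<open>The clique of a vertex and the sum over cluster graphs of given degree\<close>

lemma neighbours_subset: "E \<in> cluster_edge_sets V \<Longrightarrow> neighbours E v \<subseteq> V - {v}"
  by (auto simp: neighbours_def dest: cluster_edge_setsD)

lemma vertex_degree_eq_card_neighbours: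
  assumes "E \<in> cluster_edge_sets V"
  shows "vertex_degree E v = card (neighbours E v)"
proof -
  have E: "E \<subseteq> nsets V 2" using assms by (simp add: cluster_edge_sets_def)
  have "{e \<in> E. v \<in> e} = (\<lambda>u. {v, u}) ` neighbours E v"
  proof
    show "{e \<in> E. v \<in> e} \<subseteq> (\<lambda>u. {v, u}) ` neighbours E v"
    proof
      fix e assume e: "e \<in> {e \<in> E. v \<in> e}"
      then have "e \<in> nsets V 2" using E by auto
      then obtain a b where "e = {a, b}" by (auto simp: nsets_2_eq)
      with e show "e \<in> (\<lambda>u. {v, u}) ` neighbours E v"
        by (auto simp: neighbours_def insert_commute)
    qed
  qed (auto simp: neighbours_def)
  moreover have "inj_on (\<lambda>u. {v, u}) (neighbours E v)"
    by (auto simp: inj_on_def doubleton_eq_iff)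
  ultimately show ?thesis by (simp add: vertex_degree_def card_image)
qed

text \<open>By transitivity \<open>insert v S\<close> is a clique that no edge leaves, so such a
  graph is the complete graph on \<open>insert v S\<close> together with an arbitrary cluster graph
  on the other vertices. Adding and deleting that complete graph are mutually inverse.\<close>

lemma cluster_edge_sets_neighbours:
  assumes V: "v \<in> V" and S: "S \<subseteq> V - {v}"
  shows "bij_betw (\<lambda>E. E \<union> nsets (insert v S) 2) (cluster_edge_sets (V - insert v S))
           {E \<in> cluster_edge_sets V. neighbours E v = S}"
proof (rule bij_betw_byWitness[where f' = "\<lambda>E. E - nsets (insert v S) 2"])
  let ?T = "insert v S"
  let ?K = "nsets ?T 2"
  have disj: "E \<inter> ?K = {}" if "E \<subseteq> nsets (V - ?T) 2" for E
    using that by (fastforce simp: nsets_2_eq doubleton_eq_iff)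
  show "\<forall>E\<in>cluster_edge_sets (V - ?T). E \<union> ?K - ?K = E"
    using disj by (auto simp: cluster_edge_sets_def)
  \<comment> \<open>Any two vertices of \<open>S\<close> are joined because both are adjacent to
    \<open>v\<close>.\<close>
  have K: "?K \<subseteq> E" if E: "E \<in> cluster_edge_sets V" "neighbours E v = S" for E
  proof
    fix e assume "e \<in> ?K"
    then obtain a b where e: "e = {a, b}" "a \<in> ?T" "b \<in> ?T" "a \<noteq> b" by (auto simp: nsets_2_eq)
    have "a = v \<or> {a, v} \<in> E" "b = v \<or> {v, b} \<in> E"
      using e(2,3) E(2)[symmetric] by (auto simp: neighbours_def insert_commute)
    then show "e \<in> E"
      using e(1,4) cluster_edge_sets_trans[OF E(1), of a v b] by auto
  qed
  show "\<forall>E\<in>{E \<in> cluster_edge_sets V. neighbours E v = S}. E - ?K \<union> ?K = E"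
    using K by blast
  show "(\<lambda>E. E \<union> ?K) ` cluster_edge_sets (V - ?T) \<subseteq> {E \<in> cluster_edge_sets V. neighbours E v = S}"
  proof (clarify, intro conjI)
    fix E assume E: "E \<in> cluster_edge_sets (V - ?T)"
    have out: "a \<in> V - ?T \<and> b \<in> V - ?T \<and> a \<noteq> b" if "{a, b} \<in> E" for a b
      using E that by (rule cluster_edge_setsD)
    have "E \<union> ?K \<subseteq> nsets V 2"
      using E nsets_mono[of "V - ?T" V 2] nsets_mono[of ?T V 2] V S
      by (auto simp: cluster_edge_sets_def)
    \<comment> \<open>The middle vertex decides: \<open>E\<close> avoids \<open>?T\<close>, so
      either both edges lie in \<open>?K\<close> or both lie in \<open>E\<close>.\<close>
    moreover have "{a, c} \<in> E \<union> ?K" if "{a, b} \<in> E \<union> ?K" "{b, c} \<in> E \<union> ?K" "a \<noteq> c" for a b c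
    proof (cases "b \<in> ?T")
      case True
      then have "{a, b} \<in> ?K" "{b, c} \<in> ?K" using that(1,2) out[of a b] out[of b c] by blast+
      then show ?thesis using that(3) by simp
    next
      case False
      then have "{a, b} \<in> E" "{b, c} \<in> E" using that(1,2) by simp_all
      then show ?thesis using cluster_edge_sets_trans[OF E] that(3) by blast
    qed
    ultimately show "E \<union> ?K \<in> cluster_edge_sets V"
      by (rule cluster_edge_setsI)
    show "neighbours (E \<union> ?K) v = S"
      using out S by (auto simp: neighbours_def)
  qed
  show "(\<lambda>E. E - ?K) ` {E \<in> cluster_edge_sets V. neighbours E v = S}
          \<subseteq> cluster_edge_sets (V - ?T)"
  proof (rule image_subsetI)
    fix E assume "E \<in> {E \<in> cluster_edge_sets V. neighbours E v = S}"
    then have E: "E \<in> cluster_edge_sets V" and nb: "S = neighbours E v" by auto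
    note tr = cluster_edge_sets_trans[OF E]
    have sub: "E \<subseteq> nsets V 2"
      using E by (simp add: cluster_edge_sets_def)
    \<comment> \<open>No edge leaves the clique: an edge from a neighbour \<open>a\<close> of
      \<open>v\<close> to \<open>b\<close> makes \<open>b\<close> equal or adjacent to
      \<open>v\<close>.\<close>
    have closed: "b \<in> ?T" if "a \<in> ?T" "{a, b} \<in> E" for a b
    proof (cases "b = v \<or> a = v")
      case False
      then have "{v, a} \<in> E" using that nb by (auto simp: neighbours_def)
      then have "{v, b} \<in> E" using tr[of v a b] that False by auto
      then show ?thesis using nb by (simp add: neighbours_def)
    qed (use that nb in \<open>auto simp: neighbours_def\<close>)
    \<comment> \<open>Deleting the clique therefore amounts to restricting to the remaining
      vertices, and restriction preserves transitivity.\<close>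
    have eq: "E - ?K = E \<inter> nsets (V - ?T) 2"
    proof (intro equalityI subsetI)
      fix e assume e: "e \<in> E - ?K"
      then have "e \<in> nsets V 2" using sub by auto
      then obtain a b where ab: "e = {a, b}" "a \<in> V" "b \<in> V" "a \<noteq> b"
        by (auto simp: nsets_2_eq)
      have "{a, b} \<in> E" "{b, a} \<in> E" using e ab(1) by (simp_all add: insert_commute)
      then have "a \<in> ?T \<longleftrightarrow> b \<in> ?T" using closed by blast
      moreover have "\<not> (a \<in> ?T \<and> b \<in> ?T)" using e ab(1,4) doubleton_in_nsets_2[of a b ?T] by blast
      ultimately show "e \<in> E \<inter> nsets (V - ?T) 2"
        using e ab doubleton_in_nsets_2[of a b "V - ?T"] by blast
    qed (use disj[of "E \<inter> nsets (V - ?T) 2"] in blast)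
    show "E - ?K \<in> cluster_edge_sets (V - ?T)"
      unfolding eq
    proof (rule cluster_edge_setsI)
      fix a b c
      assume "{a, b} \<in> E \<inter> nsets (V - ?T) 2" "{b, c} \<in> E \<inter> nsets (V - ?T) 2" "a \<noteq> c"
      then show "{a, c} \<in> E \<inter> nsets (V - ?T) 2" using tr[of a b c] by simp
    qed simp
  qed
qed

lemma sum_cluster_neighbours:
  assumes fin: "finite V" and V: "v \<in> V" and S: "S \<subseteq> V - {v}"
  shows "(\<Sum>E | E \<in> cluster_edge_sets V \<and> neighbours E v = S. x ^ card E) =
           x ^ (Suc (card S) choose 2) * cluster_weight x (V - insert v S)"
proof -
  let ?K = "nsets (insert v S) 2"
  have finS: "finite S" using fin S finite_subset by blast
  have "card (E \<union> ?K) = card E + (Suc (card S) choose 2)"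
    if E: "E \<in> cluster_edge_sets (V - insert v S)" for E
  proof -
    have E': "E \<subseteq> nsets (V - insert v S) 2" using E by (simp add: cluster_edge_sets_def)
    then have "E \<inter> ?K = {}" by (fastforce simp: nsets_2_eq doubleton_eq_iff)
    moreover have "finite E" using E' fin by (meson finite_Diff finite_imp_finite_nsets finite_subset)
    moreover have "finite ?K" using finS by (simp add: finite_imp_finite_nsets)
    moreover have "v \<notin> S" using S by auto
    ultimately show ?thesis using finS by (simp add: card_Un_disjoint)
  qed
  then have "(\<Sum>E\<in>cluster_edge_sets (V - insert v S). x ^ card (E \<union> ?K)) =
      x ^ (Suc (card S) choose 2) * cluster_weight x (V - insert v S)"
    unfolding cluster_weight_def sum_distrib_left
    by (intro sum.cong) (auto simp: power_add)
  then show ?thesis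
    using sum.reindex_bij_betw[OF cluster_edge_sets_neighbours[OF V S], of "\<lambda>E. x ^ card E"]
    by simp
qed

text \<open>Grouping by the neighbourhood of \<open>v\<close> gives equal contributions from all
  \<open>k\<close>-element subsets of \<open>V - {v}\<close>. The hypothesis \<open>weight\<close>
  is confined to proper subsets so that the result can serve inside the induction for
  \<open>cluster_weight_eq\<close>, which in turn discharges it in
  \<open>sum_cluster_degree\<close>.\<close>

lemma sum_cluster_degree_aux:
  assumes fin: "finite V" and v: "v \<in> V"
    and weight: "\<And>U. U \<subset> V \<Longrightarrow> cluster_weight x U = cluster_sum x (card U)"
  shows "(\<Sum>E | E \<in> cluster_edge_sets V \<and> card (neighbours E v) = k. x ^ card E) =
       real ((card V - 1) choose k) * x ^ (Suc k choose 2) * cluster_sum x (card V - Suc k)"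
proof -
  let ?D = "{E. E \<in> cluster_edge_sets V \<and> card (neighbours E v) = k}"
  let ?N = "nsets (V - {v}) k"
  have "(\<Sum>E\<in>?D. x ^ card E) = (\<Sum>S\<in>?N. \<Sum>E | E \<in> ?D \<and> neighbours E v = S. x ^ card E)"
  proof (rule sum.group [symmetric])
    show "finite ?D" using fin by (simp add: finite_cluster_edge_sets)
    show "finite ?N" using fin by (simp add: finite_imp_finite_nsets)
    show "(\<lambda>E. neighbours E v) ` ?D \<subseteq> ?N"
    proof
      fix S assume "S \<in> (\<lambda>E. neighbours E v) ` ?D"
      then have "S \<subseteq> V - {v}" "card S = k" using neighbours_subset by fastforce+
      then show "S \<in> ?N" using fin finite_subset[of S "V - {v}"] by (simp add: nsets_def)
    qed
  qed
  also have "\<dots> = (\<Sum>S\<in>?N. x ^ (Suc k choose 2) * cluster_sum x (card V - Suc k))"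
  proof (rule sum.cong[OF refl])
    fix S assume "S \<in> ?N"
    then have S: "S \<subseteq> V - {v}" "card S = k" "finite S" by (auto simp: nsets_def)
    have "{E. E \<in> ?D \<and> neighbours E v = S} = {E. E \<in> cluster_edge_sets V \<and> neighbours E v = S}"
      using S by auto
    then have "(\<Sum>E | E \<in> ?D \<and> neighbours E v = S. x ^ card E) =
        x ^ (Suc k choose 2) * cluster_weight x (V - insert v S)"
      using sum_cluster_neighbours[OF fin v S(1), of x] S(2) by simp
    also have "cluster_weight x (V - insert v S) = cluster_sum x (card (V - insert v S))"
      by (rule weight) (use v in auto)
    also have "card (V - insert v S) = card V - Suc k"
    proof -
      have "v \<notin> S" using S by auto
      then show ?thesis using S v by (subst card_Diff_subset) auto
    qed
    finally show "(\<Sum>E | E \<in> ?D \<and> neighbours E v = S. x ^ card E) =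
        x ^ (Suc k choose 2) * cluster_sum x (card V - Suc k)" .
  qed
  finally show ?thesis using fin v by simp
qed

text \<open>Sorting the cluster graphs by the degree of one fixed vertex reproduces the recursion of
  \<open>cluster_sum\<close>. Removing a clique can leave sets of many sizes, hence the induction
  over all proper subsets.\<close>

lemma cluster_weight_eq: "finite V \<Longrightarrow> cluster_weight x V = cluster_sum x (card V)"
proof (induction V rule: finite_psubset_induct)
  case (psubset V)
  show ?case
  proof (cases "V = {}")
    case True
    have "cluster_edge_sets {} = {{}::'a set set}"
      by (auto simp: cluster_edge_sets_def nsets_2_eq)
    then show ?thesis using True by (simp add: cluster_weight_def)
  next
    case False
    then obtain v where v: "v \<in> V" by auto
    obtain n where n: "card V = Suc n" using psubset.hyps False by (metis card_eq_0_iff not0_implies_Suc)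
    have "cluster_weight x V = (\<Sum>k\<le>n. \<Sum>E | E \<in> cluster_edge_sets V \<and> card (neighbours E v) = k. x ^ card E)"
      unfolding cluster_weight_def
    proof (rule sum.group [symmetric])
      show "(\<lambda>E. card (neighbours E v)) ` cluster_edge_sets V \<subseteq> {..n}"
      proof (rule image_subsetI)
        fix E assume "E \<in> cluster_edge_sets V"
        then have "card (neighbours E v) \<le> card (V - {v})"
          using psubset.hyps by (intro card_mono neighbours_subset) auto
        then show "card (neighbours E v) \<in> {..n}" using n v psubset.hyps by simp
      qed
    qed (use psubset.hyps in \<open>auto simp: finite_cluster_edge_sets\<close>)
    also have "\<dots> = (\<Sum>k\<le>n. real (n choose k) * x ^ (Suc k choose 2) * cluster_sum x (n - k))"
    proof (rule sum.cong[OF refl])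
      fix k
      have "\<And>U. U \<subset> V \<Longrightarrow> cluster_weight x U = cluster_sum x (card U)"
        using psubset.IH by blast
      from sum_cluster_degree_aux[OF psubset.hyps v this, where k = k]
      show "(\<Sum>E | E \<in> cluster_edge_sets V \<and> card (neighbours E v) = k. x ^ card E) =
          real (n choose k) * x ^ (Suc k choose 2) * cluster_sum x (n - k)"
        by (simp add: n)
    qed
    finally show ?thesis by (simp add: n)
  qed
qed

lemma sum_cluster_degree:
  assumes "finite V" "v \<in> V"
  shows "(\<Sum>E | E \<in> cluster_edge_sets V \<and> card (neighbours E v) = k. x ^ card E) =
       real ((card V - 1) choose k) * x ^ (Suc k choose 2) * cluster_sum x (card V - Suc k)"
  using assms by (intro sum_cluster_degree_aux cluster_weight_eq) (auto intro: finite_subset)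

section \<open>Laws of the random cluster graph and of the degree\<close>

lemma pmf_erdos_renyi:
  assumes "0 \<le> p" "p < 1" and E: "E \<subseteq> nsets {1..n} 2"
  shows "pmf (erdos_renyi n p) E = (1 - p) ^ (n choose 2) * (p / (1 - p)) ^ card E"
proof -
  let ?A = "nsets {1..n} 2"
  let ?P = "Pi_pmf ?A False (\<lambda>_. bernoulli_pmf p)"
  let ?f = "\<lambda>x. {e \<in> ?A. x e}"
  have fin: "finite ?A" by (simp add: finite_imp_finite_nsets)
  have cE: "card (?A - E) + card E = n choose 2"
    using E fin card_mono[OF fin E] by (simp add: card_Diff_subset finite_subset)
  have "pmf (erdos_renyi n p) E = measure ?P (?f -` {E})"
    by (simp add: erdos_renyi_def pmf_map)
  \<comment> \<open>The preimage also contains functions that are true somewhere outside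
    \<open>?A\<close>. The default value \<open>False\<close> gives these probability zero, so only
    the indicator of \<open>E\<close> counts.\<close>
  also have "\<dots> = measure ?P {\<lambda>e. e \<in> E}"
  proof (rule measure_pmf.finite_measure_eq_AE)
    show "AE x in measure_pmf ?P. x \<in> ?f -` {E} \<longleftrightarrow> x \<in> {\<lambda>e. e \<in> E}"
    proof (rule AE_pmfI)
      fix y assume "y \<in> set_pmf ?P"
      then have "y \<in> PiE_dflt ?A False (\<lambda>_. set_pmf (bernoulli_pmf p))"
        by (simp only: set_Pi_pmf[OF fin] comp_def)
      then have "e \<in> ?A" if "y e" for e
        using that unfolding PiE_dflt_def by (cases "e \<in> ?A") simp_all
      then show "y \<in> ?f -` {E} \<longleftrightarrow> y \<in> {\<lambda>e. e \<in> E}"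
        using E by (auto simp: fun_eq_iff)
    qed
  qed auto
  also have "\<dots> = pmf ?P (\<lambda>e. e \<in> E)" by (simp add: pmf.rep_eq)
  also have "\<dots> = (\<Prod>e\<in>?A. pmf (bernoulli_pmf p) (e \<in> E))"
    using E by (intro pmf_Pi'[OF fin]) auto
  also have "\<dots> = (\<Prod>e\<in>?A - E. pmf (bernoulli_pmf p) (e \<in> E)) * (\<Prod>e\<in>E. pmf (bernoulli_pmf p) (e \<in> E))"
    by (rule prod.subset_diff[OF E fin])
  also have "\<dots> = (1 - p) ^ card (?A - E) * p ^ card E"
    using assms by simp
  also have "\<dots> = (1 - p) ^ (n choose 2) * (p / (1 - p)) ^ card E"
    using assms(2) unfolding cE[symmetric] by (simp add: power_add power_divide)
  finally show ?thesis .
qed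

text \<open>The factor \<open>(1 - p) ^ (n choose 2)\<close> is common to all graphs and cancels
  under conditioning. What remains is the odds \<open>p / (1 - p)\<close> as weight of an edge, with
  \<open>cluster_sum\<close> as partition function.\<close>

lemma pmf_random_cluster_graph:
  assumes p: "0 < p" "p < 1"
  shows "pmf (random_cluster_graph n p) E =
    (if E \<in> cluster_edge_sets {1..n} then (p / (1 - p)) ^ card E / cluster_sum (p / (1 - p)) n else 0)"
proof -
  let ?C = "cluster_edge_sets {1..n}"
  let ?x = "p / (1 - p)"
  have C: "{E. cluster_graph n E} = ?C" by (auto simp: cluster_graph_iff)
  have pmf: "pmf (erdos_renyi n p) E = (1 - p) ^ (n choose 2) * ?x ^ card E" if "E \<in> ?C" for E
    using that p by (intro pmf_erdos_renyi) (auto simp: cluster_edge_sets_def)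
  have "measure (erdos_renyi n p) ?C = (\<Sum>E\<in>?C. pmf (erdos_renyi n p) E)"
    by (simp add: measure_measure_pmf_finite finite_cluster_edge_sets)
  also have "\<dots> = (1 - p) ^ (n choose 2) * cluster_sum ?x n"
    using cluster_weight_eq[of "{1..n}" ?x]
    by (simp add: pmf cluster_weight_def flip: sum_distrib_left)
  finally have m: "measure (erdos_renyi n p) ?C = (1 - p) ^ (n choose 2) * cluster_sum ?x n" .
  show ?thesis
    using p unfolding random_cluster_graph_def pmf_cond[OF erdos_renyi_cluster_graph_nonempty[OF p]]
    by (simp add: C m pmf del: One_nat_def)
qed

lemma pmf_degree_pmf:
  assumes p: "0 < p" "p < 1" and n: "n > 0"
  defines "x \<equiv> p / (1 - p)"
  shows "pmf (degree_pmf n p) k =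
    real ((n - 1) choose k) * x ^ (Suc k choose 2) * cluster_sum x (n - Suc k) / cluster_sum x n"
proof -
  let ?C = "cluster_edge_sets {1..n}"
  \<comment> \<open>The law is the same for every fixed vertex, so averaging over a uniform vertex
    does not change it.\<close>
  have deg: "pmf (map_pmf (\<lambda>E. vertex_degree E v) (random_cluster_graph n p)) k =
      real ((n - 1) choose k) * x ^ (Suc k choose 2) * cluster_sum x (n - Suc k) / cluster_sum x n"
    if v: "v \<in> {1..n}" for v
  proof -
    let ?D = "{E. E \<in> ?C \<and> card (neighbours E v) = k}"
    have fin: "finite ?D" by (simp add: finite_cluster_edge_sets)
    have "pmf (map_pmf (\<lambda>E. vertex_degree E v) (random_cluster_graph n p)) k =
        measure (random_cluster_graph n p) ((\<lambda>E. vertex_degree E v) -` {k})"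
      by (rule pmf_map)
    also have "\<dots> = measure (random_cluster_graph n p) ?D"
    proof (rule measure_pmf.finite_measure_eq_AE)
      show "AE E in random_cluster_graph n p. E \<in> (\<lambda>E. vertex_degree E v) -` {k} \<longleftrightarrow> E \<in> ?D"
      proof (rule AE_pmfI)
        fix E assume "E \<in> set_pmf (random_cluster_graph n p)"
        then have "E \<in> ?C" by (auto simp: set_pmf_iff pmf_random_cluster_graph[OF p] split: if_splits)
        then show "E \<in> (\<lambda>E. vertex_degree E v) -` {k} \<longleftrightarrow> E \<in> ?D"
          by (simp add: vertex_degree_eq_card_neighbours)
      qed
    qed auto
    also have "\<dots> = (\<Sum>E\<in>?D. x ^ card E / cluster_sum x n)"
      unfolding measure_measure_pmf_finite[OF fin]
      by (intro sum.cong) (auto simp: pmf_random_cluster_graph[OF p] x_def)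
    finally show ?thesis
      using sum_cluster_degree[of "{1..n}" v x k] v by (simp flip: sum_divide_distrib)
  qed
  \<comment> \<open>Independence allows the vertex to be drawn first, after which \<open>deg\<close>
    applies to each vertex.\<close>
  have "degree_pmf n p = bind_pmf (pmf_of_set {1..n})
      (\<lambda>v. map_pmf (\<lambda>E. vertex_degree E v) (random_cluster_graph n p))"
    unfolding degree_pmf_def
    by (subst pair_commute_pmf)
      (simp add: pair_pmf_def map_pmf_def bind_assoc_pmf bind_return_pmf)
  then show ?thesis
    using n deg by (simp add: pmf_bind_pmf_of_set)
qed

section \<open>Recurrence for the ratios of successive cluster sums\<close>

declare cluster_sum.simps(2) [simp del]

lemma cluster_sum_pos: "x \<ge> 0 \<Longrightarrow> cluster_sum x n > 0"
proof (induction x n rule: cluster_sum.induct)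
  case (2 x n)
  have "cluster_sum x (Suc n) \<ge> (\<Sum>k\<in>{0}. real (n choose k) * x ^ (Suc k choose 2) * cluster_sum x (n - k))"
    unfolding cluster_sum.simps(2) using 2
    by (intro sum_mono2) (auto simp: less_imp_le)
  moreover have "cluster_sum x n > 0"
    using 2(1)[of 0] 2(2) by simp
  ultimately show ?case by (simp add: binomial_eq_0)
qed simp

lemma cluster_sum_Suc_ge:
  assumes "x \<ge> 0"
  shows "cluster_sum x n \<le> cluster_sum x (Suc n)"
proof -
  have "(\<Sum>k\<in>{0}. real (n choose k) * x ^ (Suc k choose 2) * cluster_sum x (n - k)) \<le> cluster_sum x (Suc n)"
    unfolding cluster_sum.simps(2) using assms cluster_sum_pos[OF assms]
    by (intro sum_mono2) (auto simp: less_imp_le)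
  then show ?thesis by (simp add: binomial_eq_0)
qed

lemma cluster_sum_mono: "x \<ge> 0 \<Longrightarrow> m \<le> n \<Longrightarrow> cluster_sum x m \<le> cluster_sum x n"
  by (rule lift_Suc_mono_le[of "cluster_sum x"]) (simp_all add: cluster_sum_Suc_ge)

text \<open>For \<open>n > 0\<close> and \<open>x = p / (1 - p)\<close> this is the probability of
  degree 0. At \<open>n = 0\<close> the truncated subtraction gives the value 1.\<close>

definition cluster_ratio :: "real \<Rightarrow> nat \<Rightarrow> real" where
  "cluster_ratio x n = cluster_sum x (n - 1) / cluster_sum x n"

text \<open>With \<open>q = N * x\<^sup>2\<close> this is the geometric tail of \<open>q ^ k\<close>
  over \<open>k \<ge> 2\<close>, divided by \<open>x\<close>. It is of order \<open>x\<close> as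
  \<open>x\<close> tends to 0 with \<open>N * x\<close> bounded.\<close>

definition large_degree_bound :: "real \<Rightarrow> nat \<Rightarrow> real" where
  "large_degree_bound x N = (N * x\<^sup>2)\<^sup>2 / (x * (1 - N * x\<^sup>2))"

lemma cluster_ratio_bounds: "x \<ge> 0 \<Longrightarrow> 0 < cluster_ratio x n" "x \<ge> 0 \<Longrightarrow> cluster_ratio x n \<le> 1"
  using cluster_sum_pos[of x] cluster_sum_mono[of x "n - 1" n]
  by (simp_all add: cluster_ratio_def)

text \<open>Equality holds at \<open>k = 1\<close> and \<open>k = 2\<close>. For
  \<open>0 < x \<le> 1\<close> it yields \<open>x ^ (Suc k choose 2) \<le> x ^ (2 * k) / x\<close>,
  which replaces the weights by a geometric series and explains the division by \<open>x\<close> in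
  \<open>large_degree_bound\<close>.\<close>

lemma choose_2_ge: "2 * k \<le> Suc (Suc k choose 2)"
  by (induction k) (auto simp: numeral_2_eq_2)

lemma sum_large_degree_le:
  fixes x :: real
  assumes x: "0 < x" "x \<le> 1" and n: "n \<le> N" and q: "N * x\<^sup>2 < 1"
  shows "(\<Sum>k=2..n. real (n choose k) * x ^ (Suc k choose 2)) \<le> large_degree_bound x N"
proof -
  let ?q = "N * x\<^sup>2"
  have "real (n choose k) * x ^ (Suc k choose 2) \<le> ?q ^ k / x" if "k \<le> n" for k
  proof -
    have "n choose k \<le> n ^ k" using that by (rule binomial_le_pow)
    also have "\<dots> \<le> N ^ k" using n by (rule power_mono) simp
    finally have "real (n choose k) \<le> real N ^ k" by (metis of_nat_le_iff of_nat_power)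
    moreover have "x * x ^ (Suc k choose 2) \<le> x ^ (2 * k)"
      using power_decreasing[OF choose_2_ge[of k], of x] x by simp
    then have "x ^ (Suc k choose 2) \<le> (x\<^sup>2) ^ k / x" using x by (simp add: field_simps flip: power_mult)
    ultimately have "real (n choose k) * x ^ (Suc k choose 2) \<le> real N ^ k * ((x\<^sup>2) ^ k / x)"
      using x by (intro mult_mono) auto
    then show ?thesis by (simp add: power_mult_distrib)
  qed
  then have "(\<Sum>k=2..n. real (n choose k) * x ^ (Suc k choose 2)) \<le> (\<Sum>k=2..n. ?q ^ k / x)"
    by (intro sum_mono) auto
  also have "\<dots> = (\<Sum>k=2..n. ?q ^ k) / x" by (simp add: sum_divide_distrib)
  also have "(\<Sum>k=2..n. ?q ^ k) \<le> ?q\<^sup>2 / (1 - ?q)"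
  proof (cases "n < 2")
    case False
    then have "(\<Sum>k=2..n. ?q ^ k) = (?q ^ 2 - ?q ^ Suc n) / (1 - ?q)"
      using q by (simp add: sum_gp)
    also have "\<dots> \<le> ?q\<^sup>2 / (1 - ?q)" using q x by (intro divide_right_mono) auto
    finally show ?thesis .
  qed (use q in auto)
  finally show ?thesis using x by (simp add: large_degree_bound_def divide_right_mono mult.commute)
qed

text \<open>The recursion is divided by \<open>cluster_sum x n\<close>: the terms
  \<open>k = 0\<close> and \<open>k = 1\<close> become \<open>1\<close> and
  \<open>n * x * cluster_ratio x n\<close>. In the remainder \<open>e\<close> the quotients of
  cluster sums are at most 1 by monotonicity, so \<open>sum_large_degree_le\<close> applies.\<close>

lemma cluster_ratio_Suc:
  assumes x: "0 < x" "x \<le> 1" and n: "n \<le> N" "n > 0" and q: "N * x\<^sup>2 < 1"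
  obtains e where "0 \<le> e" "e \<le> large_degree_bound x N"
    "cluster_ratio x (Suc n) * (1 + n * x * cluster_ratio x n + e) = 1"
proof -
  let ?t = "\<lambda>k. real (n choose k) * x ^ (Suc k choose 2)"
  define e where "e = (\<Sum>k=2..n. ?t k * (cluster_sum x (n - k) / cluster_sum x n))"
  have pos: "cluster_sum x m > 0" for m using x by (simp add: cluster_sum_pos)
  have "0 \<le> e" unfolding e_def using x pos by (intro sum_nonneg mult_nonneg_nonneg divide_nonneg_pos) (auto simp: less_imp_le)
  have "e \<le> (\<Sum>k=2..n. ?t k * 1)" unfolding e_def
    using x pos cluster_sum_mono[of x _ n]
    by (intro sum_mono mult_left_mono) auto
  also have "\<dots> \<le> large_degree_bound x N" using sum_large_degree_le[OF x n(1) q] by simp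
  finally have e_le: "e \<le> large_degree_bound x N" .
  \<comment> \<open>Here \<open>n > 0\<close> puts the index 1 in range.\<close>
  have "{..n} = insert 0 (insert 1 {2..n})" using n by auto
  then have "cluster_sum x (Suc n) = cluster_sum x n + n * x * cluster_sum x (n - 1)
      + (\<Sum>k=2..n. ?t k * cluster_sum x (n - k))"
    by (simp add: cluster_sum.simps(2) numeral_2_eq_2)
  also have "\<dots> = cluster_sum x n * (1 + n * x * cluster_ratio x n + e)"
    using pos[of n] by (simp add: cluster_ratio_def e_def field_simps sum_distrib_left)
  finally have "cluster_ratio x (Suc n) * (1 + n * x * cluster_ratio x n + e) = 1"
    using pos[of "Suc n"] unfolding cluster_ratio_def
    by (metis diff_Suc_1 less_numeral_extra(3) right_inverse_eq times_divide_eq_left)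
  with \<open>0 \<le> e\<close> e_le that show thesis by blast
qed

section \<open>Contraction in logarithmic coordinates and the limit of the ratios\<close>

lemma tendsto_zero_iterated_contraction:
  fixes y d :: "nat \<Rightarrow> nat \<Rightarrow> real"
  assumes c: "0 \<le> c" "c < 1" and nonneg: "\<And>n j. y n j \<ge> 0"
    and bdd: "\<And>j. eventually (\<lambda>n. y n j \<le> B) sequentially"
    and step: "\<And>j. eventually (\<lambda>n. y n j \<le> c * y n (Suc j) + d n j) sequentially"
    and d: "\<And>j. (\<lambda>n. d n j) \<longlonglongrightarrow> 0"
  shows "(\<lambda>n. y n j) \<longlonglongrightarrow> 0"
proof -
  \<comment> \<open>Contracting \<open>J\<close> times, from \<open>j\<close> up to
    \<open>j + J\<close>, leaves \<open>c ^ J * B\<close> plus vanishing errors. As \<open>J\<close>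
    stays fixed while \<open>n\<close> grows, only finitely many eventual statements are combined.
    Afterwards \<open>J\<close> is chosen to make \<open>c ^ J * B\<close> small.\<close>
  have iter: "eventually (\<lambda>n. y n j \<le> c ^ J * B + e) sequentially" if "e > 0" for J j e
    using that
  proof (induction J arbitrary: j e)
    case 0
    from bdd[of j] show ?case by eventually_elim (use 0 in auto)
  next
    case (Suc J)
    from Suc.prems have "e / 2 > 0" by simp
    from Suc.IH[OF this, of "Suc j"] step[of j] order_tendstoD(2)[OF d[of j] this] show ?case
    proof eventually_elim
      case (elim n)
      have "c * y n (Suc j) \<le> c * (c ^ J * B + e / 2)" using elim c by (intro mult_left_mono) auto
      also have "\<dots> \<le> c ^ Suc J * B + e / 2"
        using c Suc.prems by (simp add: algebra_simps mult_left_le_one_le)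
      finally show ?case using elim by linarith
    qed
  qed
  show ?thesis
  proof (rule order_tendstoI)
    fix a :: real assume "a < 0"
    then show "eventually (\<lambda>n. a < y n j) sequentially"
      using nonneg by (intro always_eventually allI) (meson less_le_trans)
  next
    fix a :: real assume a: "0 < a"
    have "(\<lambda>J. c ^ J * B) \<longlonglongrightarrow> 0 * B"
      using c by (intro tendsto_intros LIMSEQ_realpow_zero)
    then have "eventually (\<lambda>J. c ^ J * B < a / 2) sequentially"
      using a by (intro order_tendstoD) auto
    then obtain J where "c ^ J * B < a / 2" by (auto simp: eventually_sequentially)
    with iter[of "a / 2" j J] a show "eventually (\<lambda>n. y n j < a) sequentially"
      by (auto elim!: eventually_mono)
  qed
qed

text \<open>With respect to \<open>ln t\<close>, the derivative of \<open>ln (1 + a * t)\<close> is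
  \<open>a * t / (1 + a * t)\<close>, which is at most \<open>a / (1 + a)\<close> for
  \<open>0 < t \<le> 1\<close>.\<close>

lemma ln_one_plus_mult_contraction:
  fixes a u v :: real
  assumes a: "a > 0" and u: "0 < u" "u \<le> 1" and v: "0 < v" "v \<le> 1"
  shows "\<bar>ln (1 + a * u) - ln (1 + a * v)\<bar> \<le> a / (1 + a) * \<bar>ln u - ln v\<bar>"
proof -
  have *: "ln (1 + a * v) - ln (1 + a * u) \<le> a / (1 + a) * (ln v - ln u)"
    if uv: "0 < u" "u \<le> v" "v \<le> 1" for u v :: real
  proof -
    let ?f = "\<lambda>t. a / (1 + a) * ln t - ln (1 + a * t)"
    have "?f u \<le> ?f v"
    proof (rule DERIV_nonneg_imp_nondecreasing[OF uv(2)])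
      fix t assume t: "u \<le> t" "t \<le> v"
      then have t': "0 < t" "t \<le> 1" using uv by auto
      have pos: "1 + a * t > 0" using t' a by (simp add: add_pos_pos)
      have "(?f has_real_derivative (a / (1 + a) * (1 / t) - a / (1 + a * t))) (at t)"
        using t' a pos by (auto intro!: derivative_eq_intros)
      moreover have "a / (1 + a * t) \<le> a / ((1 + a) * t)"
        using t' a pos by (intro divide_left_mono mult_pos_pos) (auto simp: algebra_simps)
      ultimately show "\<exists>y. (?f has_real_derivative y) (at t) \<and> 0 \<le> y"
        by (intro exI[of _ "a / (1 + a) * (1 / t) - a / (1 + a * t)"]) simp
    qed
    then show ?thesis by (simp add: right_diff_distrib)
  qed
  have mono: "ln u \<le> ln v \<and> ln (1 + a * u) \<le> ln (1 + a * v)" if "0 < u" "u \<le> v" for u v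
    using that a by (auto simp: add_pos_pos)
  show ?thesis
  proof (cases "u \<le> v")
    case True
    then show ?thesis using *[of u v] mono[of u v] u v by simp
  next
    case False
    then show ?thesis using *[of v u] mono[of v u] u v by simp
  qed
qed

text \<open>This is \<open>ln z \<le> z - 1\<close> with \<open>z\<close> the quotient of the two
  arguments. It bounds the cost of replacing the coefficient in the recurrence by \<open>lam\<close>
  and dropping the error \<open>e\<close>.\<close>

lemma abs_ln_one_plus_diff_le:
  fixes u v :: real
  assumes "u \<ge> 0" "v \<ge> 0"
  shows "\<bar>ln (1 + u) - ln (1 + v)\<bar> \<le> \<bar>u - v\<bar>"
proof -
  have *: "ln (1 + v) - ln (1 + u) \<le> v - u" if "0 \<le> u" "u \<le> v" for u v :: real
  proof -
    have "ln (1 + v) - ln (1 + u) = ln ((1 + v) / (1 + u))" using that by (simp add: ln_div)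
    also have "\<dots> \<le> (1 + v) / (1 + u) - 1" using that by (intro ln_le_minus_one) auto
    also have "\<dots> = (v - u) / (1 + u)" using that by (simp add: field_simps)
    also have "\<dots> \<le> (v - u) / 1" using that by (intro divide_left_mono) auto
    finally show ?thesis by simp
  qed
  show ?thesis
  proof (cases "u \<le> v")
    case True
    then show ?thesis using *[of u v] assms by (simp add: abs_if)
  next
    case False
    then show ?thesis using *[of v u] assms by (simp add: abs_if)
  qed
qed
text \<open>The offset \<open>j\<close> counts steps back from \<open>n\<close> at the fixed
  parameter \<open>x n\<close>. The recurrence bounds offset \<open>j\<close> by offset
  \<open>Suc j\<close>, so all offsets are treated together. The equation for \<open>R\<close> makes
  it the fixed point of the limiting map that sends \<open>r\<close> to
  \<open>1 / (1 + lam * r)\<close>.\<close>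

lemma cluster_ratio_tendsto:
  fixes x :: "nat \<Rightarrow> real"
  assumes x: "eventually (\<lambda>n. x n > 0) sequentially" and lam: "lam > 0"
    and lim: "(\<lambda>n. real n * x n) \<longlonglongrightarrow> lam"
    and R: "0 < R" "lam * R\<^sup>2 + R = 1"
  shows "(\<lambda>n. cluster_ratio (x n) (n - j)) \<longlonglongrightarrow> R"
proof -
  define c where "c = lam / (1 + lam)"
  \<comment> \<open>Since ratios are at most 1, the recurrence eventually bounds the inverse ratio
    by \<open>1 + (lam + 1) + 1\<close>, which is \<open>lam + 3\<close>.\<close>
  define B where "B = \<bar>ln (lam + 3)\<bar> + \<bar>ln R\<bar>"
  define \<eta> where "\<eta> n = large_degree_bound (x n) n" for n
  define y where "y n j = \<bar>ln (cluster_ratio (x n) (n - j)) - ln R\<bar>" for n j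
  \<comment> \<open>The two errors of one step: the deviation of the coefficient from
    \<open>lam\<close>, and the contribution of degrees at least 2.\<close>
  define d where "d n j = \<bar>real (n - Suc j) * x n - lam\<bar> + \<eta> n" for n j :: nat
  have x0: "x \<longlonglongrightarrow> 0"
  proof -
    have "(\<lambda>n. real n * x n * (1 / real n)) \<longlonglongrightarrow> lam * 0"
      by (intro tendsto_mult lim lim_1_over_n)
    moreover have "eventually (\<lambda>n. real n * x n * (1 / real n) = x n) sequentially"
      using eventually_gt_at_top[of 0] by eventually_elim simp
    ultimately show ?thesis using Lim_transform_eventually by fastforce
  qed
  have q0: "(\<lambda>n. real n * (x n)\<^sup>2) \<longlonglongrightarrow> 0"
    using tendsto_mult[OF lim x0] by (simp add: power2_eq_square mult.assoc)
  have \<eta>0: "\<eta> \<longlonglongrightarrow> 0"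
  proof -
    \<comment> \<open>The division by \<open>x n\<close> cancels, which leaves one factor tending to
      \<open>lam\<close> and one tending to 0.\<close>
    have "(\<lambda>n. (real n * x n) * (real n * (x n)\<^sup>2) / (1 - real n * (x n)\<^sup>2)) \<longlonglongrightarrow> lam * 0 / (1 - 0)"
      by (intro tendsto_intros lim q0) simp
    moreover have "eventually (\<lambda>n. (real n * x n) * (real n * (x n)\<^sup>2) / (1 - real n * (x n)\<^sup>2) = \<eta> n) sequentially"
      using x by eventually_elim (simp add: \<eta>_def large_degree_bound_def power2_eq_square)
    ultimately show ?thesis using Lim_transform_eventually by fastforce
  qed
  have a_lim: "(\<lambda>n. real (n - Suc j) * x n) \<longlonglongrightarrow> lam" for j
  proof -
    have "(\<lambda>n. real n * x n - real (Suc j) * x n) \<longlonglongrightarrow> lam - real (Suc j) * 0"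
      by (intro tendsto_intros lim x0)
    moreover have "eventually (\<lambda>n. real n * x n - real (Suc j) * x n = real (n - Suc j) * x n) sequentially"
      using eventually_ge_at_top[of "Suc j"] by eventually_elim (simp add: of_nat_diff algebra_simps)
    ultimately show ?thesis using Lim_transform_eventually by fastforce
  qed
  have d0: "(\<lambda>n. d n j) \<longlonglongrightarrow> 0" for j
  proof -
    have "(\<lambda>n. d n j) \<longlonglongrightarrow> \<bar>lam - lam\<bar> + 0"
      unfolding d_def by (intro tendsto_intros a_lim \<eta>0)
    then show ?thesis by simp
  qed
  have R1: "R \<le> 1" "1 + lam * R = 1 / R"
    using R lam by (auto simp: field_simps power2_eq_square) (smt (verit) mult_nonneg_nonneg)
  have rec: "eventually (\<lambda>n. \<exists>e. 0 \<le> e \<and> e \<le> \<eta> n \<and>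
      ln (cluster_ratio (x n) (n - j)) =
        - ln (1 + (real (n - Suc j) * x n * cluster_ratio (x n) (n - Suc j) + e))) sequentially" for j
    using x order_tendstoD(2)[OF x0, of 1, simplified] order_tendstoD(2)[OF q0, of 1, simplified]
      eventually_gt_at_top[of "Suc j"]
  proof eventually_elim
    case (elim n)
    then have "n - Suc j \<le> n" "n - Suc j > 0" by auto
    from cluster_ratio_Suc[OF elim(1) less_imp_le[OF elim(2)] this elim(3)]
    obtain e where e: "0 \<le> e" "e \<le> \<eta> n" "cluster_ratio (x n) (Suc (n - Suc j)) *
        (1 + real (n - Suc j) * x n * cluster_ratio (x n) (n - Suc j) + e) = 1"
      unfolding \<eta>_def by blast
    let ?Q = "1 + (real (n - Suc j) * x n * cluster_ratio (x n) (n - Suc j) + e)"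
    have "?Q > 0"
      using e(1) elim(1) cluster_ratio_bounds(1)[of "x n" "n - Suc j"] by (intro add_pos_nonneg) auto
    moreover have "Suc (n - Suc j) = n - j" using elim by simp
    ultimately have "?Q * cluster_ratio (x n) (n - j) = 1"
      using e(3) by (simp add: add.assoc mult.commute)
    then have "cluster_ratio (x n) (n - j) = inverse ?Q" by (rule inverse_unique [symmetric])
    with \<open>?Q > 0\<close> e show ?case by (intro exI[of _ e]) (simp add: ln_inverse)
  qed
  have "(\<lambda>n. y n j) \<longlonglongrightarrow> 0"
  proof (rule tendsto_zero_iterated_contraction[where c = c and B = B and d = d])
    show "0 \<le> c" "c < 1" using lam by (auto simp: c_def)
    show "y n j \<ge> 0" for n j by (simp add: y_def)
    show "(\<lambda>n. d n j) \<longlonglongrightarrow> 0" for j by (rule d0)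
    show "eventually (\<lambda>n. y n j \<le> B) sequentially" for j
      using rec[of j] x order_tendstoD(2)[OF a_lim[of j], of "lam + 1", simplified]
        order_tendstoD(2)[OF \<eta>0, of 1, simplified]
    proof eventually_elim
      case (elim n)
      then obtain e where e: "0 \<le> e" "e \<le> \<eta> n" "ln (cluster_ratio (x n) (n - j)) =
          - ln (1 + (real (n - Suc j) * x n * cluster_ratio (x n) (n - Suc j) + e))" by blast
      let ?r = "cluster_ratio (x n) (n - Suc j)"
      have r: "0 < ?r" "?r \<le> 1" using cluster_ratio_bounds elim by auto
      have "real (n - Suc j) * x n * ?r \<le> real (n - Suc j) * x n"
        using r elim(2) by (intro mult_left_le) auto
      moreover have "0 \<le> real (n - Suc j) * x n * ?r" using r elim(2) by simp
      ultimately have "0 \<le> ln (1 + (real (n - Suc j) * x n * ?r + e))"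
        "ln (1 + (real (n - Suc j) * x n * ?r + e)) \<le> ln (lam + 3)"
        using e elim by auto
      then show ?case unfolding y_def B_def e(3) by linarith
    qed
    show "eventually (\<lambda>n. y n j \<le> c * y n (Suc j) + d n j) sequentially" for j
      using rec[of j] x
    proof eventually_elim
      case (elim n)
      then obtain e where e: "0 \<le> e" "e \<le> \<eta> n" "ln (cluster_ratio (x n) (n - j)) =
          - ln (1 + (real (n - Suc j) * x n * cluster_ratio (x n) (n - Suc j) + e))" by blast
      let ?r = "cluster_ratio (x n) (n - Suc j)" and ?a = "real (n - Suc j) * x n"
      have r: "0 < ?r" "?r \<le> 1" using cluster_ratio_bounds elim by auto
      have "ln R = - ln (1 + lam * R)" using R R1 by (simp add: ln_div)
      then have "y n j = \<bar>ln (1 + (?a * ?r + e)) - ln (1 + lam * R)\<bar>"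
        unfolding y_def e(3) by linarith
      \<comment> \<open>The comparison passes through \<open>ln (1 + lam * ?r)\<close>: from there
        to the fixed point the map contracts, and reaching it costs at most
        \<open>d n j\<close>.\<close>
      also have "\<dots> \<le> \<bar>ln (1 + (?a * ?r + e)) - ln (1 + lam * ?r)\<bar> +
          \<bar>ln (1 + lam * ?r) - ln (1 + lam * R)\<bar>" by linarith
      also have "\<bar>ln (1 + lam * ?r) - ln (1 + lam * R)\<bar> \<le> c * y n (Suc j)"
        unfolding c_def y_def using lam r R(1) R1(1) by (rule ln_one_plus_mult_contraction)
      also have "\<bar>ln (1 + (?a * ?r + e)) - ln (1 + lam * ?r)\<bar> \<le> \<bar>(?a * ?r + e) - lam * ?r\<bar>"
        using lam r e elim(2) by (intro abs_ln_one_plus_diff_le) auto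
      also have "\<dots> = \<bar>(?a - lam) * ?r + e\<bar>" by (simp add: algebra_simps)
      also have "\<dots> \<le> \<bar>?a - lam\<bar> * ?r + e" using r e by (simp add: abs_mult order_trans[OF abs_triangle_ineq])
      also have "\<dots> \<le> \<bar>?a - lam\<bar> + \<eta> n" using r e by (intro add_mono mult_left_le) auto
      finally show ?case by (simp add: d_def)
    qed
  qed
  then have "(\<lambda>n. ln (cluster_ratio (x n) (n - j)) - ln R) \<longlonglongrightarrow> 0"
    unfolding y_def by (rule tendsto_rabs_zero_cancel)
  then have "(\<lambda>n. exp (ln (cluster_ratio (x n) (n - j)) - ln R + ln R)) \<longlonglongrightarrow> exp (0 + ln R)"
    by (intro tendsto_intros)
  moreover have "eventually (\<lambda>n. exp (ln (cluster_ratio (x n) (n - j)) - ln R + ln R)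
      = cluster_ratio (x n) (n - j)) sequentially"
    using x by eventually_elim (simp add: cluster_ratio_bounds)
  ultimately show ?thesis using R Lim_transform_eventually by fastforce
qed

section \<open>Limits of the degree probabilities\<close>

lemma degree_pmf_tendsto:
  fixes p :: "nat \<Rightarrow> real"
  assumes p01: "\<And>n. n \<ge> 1 \<Longrightarrow> 0 < p n \<and> p n < 1"
    and lam: "lam > 0" and asymp: "p \<sim>[sequentially] (\<lambda>n. lam / real n)"
  defines "R \<equiv> (sqrt (4 * lam + 1) - 1) / (2 * lam)"
  shows "(\<lambda>n. pmf (degree_pmf n (p n)) 0) \<longlonglongrightarrow> R"
    and "(\<lambda>n. pmf (degree_pmf n (p n)) 1) \<longlonglongrightarrow> 1 - R"
proof -
  define x where "x n = p n / (1 - p n)" for n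
  have np: "(\<lambda>n. real n * p n) \<longlonglongrightarrow> lam"
  proof -
    have "(\<lambda>n. p n / (lam / real n)) \<longlonglongrightarrow> 1"
      using asymp lam by (intro asymp_equivD_strong) (auto intro: eventually_mono[OF eventually_gt_at_top[of 0]])
    then have "(\<lambda>n. lam * (p n / (lam / real n))) \<longlonglongrightarrow> lam * 1"
      by (intro tendsto_intros)
    then show ?thesis using lam by (simp add: mult.commute)
  qed
  have p0: "p \<longlonglongrightarrow> 0"
  proof -
    have "(\<lambda>n. real n * p n * (1 / real n)) \<longlonglongrightarrow> lam * 0"
      by (intro tendsto_mult np lim_1_over_n)
    moreover have "eventually (\<lambda>n. real n * p n * (1 / real n) = p n) sequentially"
      using eventually_gt_at_top[of 0] by eventually_elim simp
    ultimately show ?thesis using Lim_transform_eventually by fastforce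
  qed
  have xpos: "eventually (\<lambda>n. x n > 0) sequentially"
    using eventually_ge_at_top[of 1] by eventually_elim (use p01 in \<open>simp add: x_def\<close>)
  have nx: "(\<lambda>n. real n * x n) \<longlonglongrightarrow> lam"
  proof -
    have "(\<lambda>n. real n * p n / (1 - p n)) \<longlonglongrightarrow> lam / (1 - 0)"
      by (intro tendsto_intros np p0) simp
    then show ?thesis by (simp add: x_def)
  qed
  have x0: "x \<longlonglongrightarrow> 0"
  proof -
    have "(\<lambda>n. p n / (1 - p n)) \<longlonglongrightarrow> 0 / (1 - 0)"
      by (intro tendsto_intros p0) simp
    then show ?thesis by (simp add: x_def[abs_def])
  qed
  have s: "sqrt (4 * lam + 1) > 1" using lam by simp
  have R0: "0 < R" using s lam by (simp add: R_def)
  have Req: "lam * R\<^sup>2 + R = 1"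
  proof -
    \<comment> \<open>The definition of \<open>R\<close> makes \<open>2 * lam * R + 1\<close> equal
      to \<open>sqrt (4 * lam + 1)\<close>. Squaring gives the quadratic equation up to the factor
      \<open>4 * lam\<close>.\<close>
    have "(2 * lam * R + 1)\<^sup>2 = 4 * lam + 1"
      using lam by (simp add: R_def)
    then have "4 * lam * (lam * R\<^sup>2 + R) = 4 * lam * 1"
      by (simp add: power2_eq_square algebra_simps)
    then show ?thesis using lam by simp
  qed
  note ratio = cluster_ratio_tendsto[OF xpos lam nx R0 Req]
  have "eventually (\<lambda>n. cluster_ratio (x n) (n - 0) = pmf (degree_pmf n (p n)) 0) sequentially"
    using eventually_ge_at_top[of 1]
    by eventually_elim
      (use p01 in \<open>simp add: pmf_degree_pmf cluster_ratio_def x_def binomial_eq_0\<close>)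
  with ratio[of 0] show "(\<lambda>n. pmf (degree_pmf n (p n)) 0) \<longlonglongrightarrow> R"
    using Lim_transform_eventually by fastforce
  \<comment> \<open>The probability of degree 1 is \<open>(n - 1) * x n\<close> times two successive
    ratios, so its limit is \<open>lam * R\<^sup>2\<close>.\<close>
  have "(\<lambda>n. (real n * x n - x n) * cluster_ratio (x n) (n - 1) * cluster_ratio (x n) (n - 0))
      \<longlonglongrightarrow> (lam - 0) * R * R"
    by (intro tendsto_intros nx x0 ratio)
  also have "(lam - 0) * R * R = 1 - R" using Req by (simp add: power2_eq_square)
  finally have lim: "(\<lambda>n. (real n * x n - x n) * cluster_ratio (x n) (n - 1) * cluster_ratio (x n) (n - 0))
      \<longlonglongrightarrow> 1 - R" .
  have "eventually (\<lambda>n. (real n * x n - x n) * cluster_ratio (x n) (n - 1) * cluster_ratio (x n) (n - 0)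
      = pmf (degree_pmf n (p n)) 1) sequentially"
    using eventually_ge_at_top[of 2] xpos
  proof eventually_elim
    case (elim n)
    then have "cluster_sum (x n) (n - 1) > 0" by (simp add: cluster_sum_pos)
    moreover have "real (n - 1) = real n - 1" "n - 1 - 1 = n - 2" using elim by (simp_all add: of_nat_diff)
    moreover have "pmf (degree_pmf n (p n)) 1 =
        real (n - 1) * x n * cluster_sum (x n) (n - 2) / cluster_sum (x n) n"
      using pmf_degree_pmf[of "p n" n 1] p01[of n] elim by (simp add: x_def numeral_2_eq_2)
    moreover have "real n * x n - x n = (real n - 1) * x n" by (simp add: algebra_simps)
    ultimately show ?case by (simp add: cluster_ratio_def)
  qed
  with lim show "(\<lambda>n. pmf (degree_pmf n (p n)) 1) \<longlonglongrightarrow> 1 - R"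
    using Lim_transform_eventually by fastforce
qed

theorem theorem1p6:
  fixes p :: "nat \<Rightarrow> real"
  assumes p01: "\<And>n. n \<ge> 1 \<Longrightarrow> 0 < p n \<and> p n < 1"
  shows
    "(\<forall>lam::real. lam > 0 \<and> p \<sim>[sequentially] (\<lambda>n. lam / real n) \<longrightarrow>
        ((\<lambda>n. pmf (degree_pmf n (p n)) 0) \<longlonglongrightarrow> (sqrt (4 * lam + 1) - 1) / (2 * lam)) \<and>
        ((\<lambda>n. pmf (degree_pmf n (p n)) 1) \<longlonglongrightarrow> 1 - (sqrt (4 * lam + 1) - 1) / (2 * lam)))
     \<and> (p \<sim>[sequentially] (\<lambda>n. 1 / real n) \<longrightarrow>
        (\<lambda>n. pmf (degree_pmf n (p n)) 0) \<longlonglongrightarrow> inverse ((sqrt 5 + 1) / 2))"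
proof (intro conjI allI impI)
  assume "p \<sim>[sequentially] (\<lambda>n. 1 / real n)"
  then have "(\<lambda>n. pmf (degree_pmf n (p n)) 0) \<longlonglongrightarrow> (sqrt (4 * 1 + 1) - 1) / (2 * 1)"
    by (intro degree_pmf_tendsto(1) p01) auto
  also have "(sqrt (4 * 1 + 1) - 1) / (2 * 1) = inverse ((sqrt 5 + 1) / 2)"
  proof (rule inverse_unique [symmetric])
    \<comment> \<open>This is \<open>(sqrt 5 + 1) * (sqrt 5 - 1) = 4\<close>.\<close>
    show "(sqrt 5 + 1) / 2 * ((sqrt (4 * 1 + 1) - 1) / (2 * 1)) = 1"
      by (simp add: algebra_simps)
  qed
  finally show "(\<lambda>n. pmf (degree_pmf n (p n)) 0) \<longlonglongrightarrow> inverse ((sqrt 5 + 1) / 2)" .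
qed (auto simp del: One_nat_def intro!: degree_pmf_tendsto p01)

end
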